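(* Let $P=P_1\cdots P_\kappa$ be a product of linear forms as in the context, in the variables $x_1,\dots,x_r$. The abscissa of convergence of $$\zeta(P;s)=\sum_{x_1,\dots,x_r=1}^{\infty}P(x_1,\dots,x_r)^{-s}$$ equals $r/\kappa$ if and only if the inequality $r(Q)/\kappa(Q)\ge r/\kappa$ holds for every (non-empty) subpolynomial $Q$ of $P$.
   Context: $P=P_1\cdots P_\kappa$ where each $P_i=a_{i1}x_1+a_{i2}x_2+\cdots+a_{ir}x_r$ is a linear polynomial over $\mathbb{R}$ in the $r$ variables $x_1,\dots,x_r$, with all coefficients $a_{ij}$ non-negative and, for each $i$, at least one $a_{ij}$ positive. Thus $\kappa$ is both the number of linear factors and the degree of $P$. For any subset of variables $\{x_{j_1},\dots,x_{j_l}\}$, the subpolynomial $Q=P[j_1,\dots,j_l]$ is the product of those linear factors of $P$ which contain only the variables $x_{j_1},\dots,x_{j_l}$ with a non-zero coefficient. One writes $r(Q)$ for $l$, the number of variables, and $\kappa(Q)$ for the number of linear factors in $Q$, which is also the degree of $Q$. The empty subpolynomial is $1$, with no variables and degree $0$. The abscissa of convergence of $\zeta(P;s)$ is the infimum of the real numbers $s$ for which the series converges. *)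

theory Defs
  imports "HOL-Analysis.Analysis"
begin

text \<open>
  A product of linear forms is kept together with its set of variables (given by their indices) and
  its list of linear factors, each factor being its coefficient function. Both are part of the data:
  different sets of variables may select the same factors, and repeated or proportional factors
  are counted separately.
\<close>

datatype lin_prod = Lin_Prod (vars: "nat set") (factors: "(nat \<Rightarrow> real) list")

definition num_vars :: "lin_prod \<Rightarrow> nat" where
  "num_vars P = card (vars P)"

definition num_factors :: "lin_prod \<Rightarrow> nat" where
  "num_factors P = length (factors P)"

definition eval_lin_prod :: "lin_prod \<Rightarrow> (nat \<Rightarrow> real) \<Rightarrow> real" where
  "eval_lin_prod P x = (\<Prod>c\<leftarrow>factors P. \<Sum>j\<in>vars P. c j * x j)"

definition subpoly :: "lin_prod \<Rightarrow> nat set \<Rightarrow> lin_prod" where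
  "subpoly P J = Lin_Prod J (filter (\<lambda>c. {j \<in> vars P. c j \<noteq> 0} \<subseteq> J) (factors P))"

text \<open>
  The terms of the series are positive as soon as every factor has nonnegative coefficients, not all
  zero, so unconditional summability is convergence of the multiple series.
\<close>

definition zeta_converges :: "lin_prod \<Rightarrow> real \<Rightarrow> bool" where
  "zeta_converges P s \<longleftrightarrow>
     (\<lambda>x. eval_lin_prod P (\<lambda>j. real (x j)) powr (- s)) summable_on (vars P \<rightarrow>\<^sub>E {1::nat..})"

text \<open>
  The infimum is taken in the extended reals: it is \<open>\<infinity>\<close> if the series converges for no real \<open>s\<close>,
  for instance if some variable occurs in none of the factors.
\<close>

definition abscissa_of_convergence :: "lin_prod \<Rightarrow> ereal" where
  "abscissa_of_convergence P = Inf {ereal s | s. zeta_converges P s}"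

text \<open>
  In the extended reals, a positive number divided by \<open>0\<close> is \<open>\<infinity>\<close>. This is the intended value for a
  nonempty set of variables that supports no factor.
\<close>

definition var_factor_ratio :: "lin_prod \<Rightarrow> ereal" where
  "var_factor_ratio P = ereal (real (num_vars P)) / ereal (real (num_factors P))"

end

theory Submission
  imports Defs "HOL-Real_Asymp.Real_Asymp"
begin

text \<open>
  For a set \<open>A\<close> of variables let \<open>m A\<close> be the number of linear factors in which some variable of \<open>A\<close>
  occurs. If the variables outside \<open>J\<close> form the set \<open>A\<close>, then the factors of the subpolynomial on
  \<open>J\<close> are the \<open>\<kappa> - m A\<close> factors that avoid \<open>A\<close>, and the inequality \<open>card J / (\<kappa> - m A) \<ge> r / \<kappa>\<close> is
  equivalent to \<open>\<kappa> * card A \<le> r * m A\<close>. For \<open>J = {1..r}\<close> or \<open>A = {1..r}\<close> the latter holds trivially. So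
  the theorem says that the abscissa is \<open>r / \<kappa>\<close> iff \<open>\<kappa> * card A \<le> r * m A\<close> for all nonempty \<open>A\<close>.

  Necessity comes from counting (\<open>card_le_of_summable\<close>). The box in which the variables of \<open>A\<close> range
  over \<open>{1..N}\<close> and all others are \<open>1\<close> has \<open>N ^ card A\<close> points, and \<open>P\<close> is at most a constant times
  \<open>N ^ m A\<close> there, so convergence at \<open>s > 0\<close> forces \<open>card A \<le> s * m A\<close>. With all variables in \<open>A\<close>
  this shows that the abscissa is never below \<open>r / \<kappa>\<close>.

  Sufficiency rests on a pointwise bound. Put \<open>y j = ln (x j)\<close>; up to a constant factor, a linear form
  at \<open>x\<close> is at least the exponential of the maximum of \<open>y\<close> over its variables. Slicing \<open>y\<close> into
  layers \<open>{j. y j \<ge> t}\<close> turns the inequalities \<open>q * card A \<le> s * m A\<close> for all \<open>A\<close> into the inequality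
  \<open>q * (\<Sum>j. y j) \<le> s * (\<Sum>i. max of y over the i-th factor)\<close> (\<open>weighted_sum_le_sum_Max\<close>). Hence
  \<open>P powr (- s)\<close> is bounded by a constant times the product of the \<open>x j powr (- q)\<close>, which is
  summable for \<open>q > 1\<close>. If \<open>\<kappa> * card A \<le> r * m A\<close> for all \<open>A\<close>, every \<open>s > r / \<kappa>\<close> is admissible with
  \<open>q = s * \<kappa> / r\<close>.
\<close>

section \<open>Reduction of the sum of maxima to subsets\<close>

text \<open>
  The hypothesis on subsets is the conclusion for indicator functions \<open>y\<close>. Both sides of the
  conclusion are additive when the indicator function of the support of \<open>y\<close>, times the least positive
  value of \<open>y\<close>, is split off, so the general case follows by induction on the size of the support.
\<close>

lemma weighted_sum_le_sum_Max:
  fixes q s :: real and y :: "'v \<Rightarrow> real" and S :: "'i \<Rightarrow> 'v set"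
  assumes "finite I" "finite V"
    and S: "\<And>i. i \<in> I \<Longrightarrow> S i \<subseteq> V \<and> S i \<noteq> {}"
    and subsets: "\<And>A. A \<subseteq> V \<Longrightarrow> A \<noteq> {} \<Longrightarrow> q * card A \<le> s * card {i \<in> I. S i \<inter> A \<noteq> {}}"
    and y: "\<And>j. j \<in> V \<Longrightarrow> 0 \<le> y j"
  shows "q * (\<Sum>j\<in>V. y j) \<le> s * (\<Sum>i\<in>I. Max (y ` S i))"
  using y
proof (induction "card {j \<in> V. y j \<noteq> 0}" arbitrary: y rule: less_induct)
  case less
  define A where "A = {j \<in> V. y j \<noteq> 0}"
  have A: "A \<subseteq> V" "finite A"
    using \<open>finite V\<close> by (auto simp: A_def)
  have S_fin: "finite (S i)" "S i \<noteq> {}" "S i \<subseteq> V" if "i \<in> I" for i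
    using S[OF that] \<open>finite V\<close> finite_subset by auto
  show ?case
  proof (cases "A = {}")
    case True
    then have y0: "y j = 0" if "j \<in> V" for j
      using that by (auto simp: A_def)
    have "Max (y ` S i) = 0" if "i \<in> I" for i
    proof -
      have "y ` S i = {0}"
        using y0 S_fin[OF that] by force
      then show ?thesis by simp
    qed
    then show ?thesis
      using y0 by simp
  next
    case False
    define t where "t = Min (y ` A)"
    define y' where "y' j = y j - (if j \<in> A then t else 0)" for j
    have t_le: "t \<le> y j" if "j \<in> A" for j
      using that A by (simp add: t_def)
    have "t \<in> y ` A"
      unfolding t_def using A False by (intro Min_in) auto
    then obtain k where k: "k \<in> A" "y k = t"
      by auto
    have "0 < t"
      using k less.prems[of k] by (auto simp: A_def)
    have y'_nonneg: "0 \<le> y' j" if "j \<in> V" for j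
      using that t_le less.prems by (auto simp: y'_def)
    have "{j \<in> V. y' j \<noteq> 0} \<subset> A"
      using k by (auto simp: y'_def A_def)
    then have "card {j \<in> V. y' j \<noteq> 0} < card A"
      using A by (intro psubset_card_mono)
    then have IH: "q * (\<Sum>j\<in>V. y' j) \<le> s * (\<Sum>i\<in>I. Max (y' ` S i))"
      using less.hyps[of y'] y'_nonneg by (simp add: A_def)
    have sum_y: "(\<Sum>j\<in>V. y j) = t * card A + (\<Sum>j\<in>V. y' j)"
    proof -
      have "(\<Sum>j\<in>V. y j) = (\<Sum>j\<in>V. (if j \<in> A then t else 0) + y' j)"
        by (simp add: y'_def)
      also have "\<dots> = (\<Sum>j\<in>V. if j \<in> A then t else 0) + (\<Sum>j\<in>V. y' j)"
        by (rule sum.distrib)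
      also have "(\<Sum>j\<in>V. if j \<in> A then t else 0) = (\<Sum>j\<in>A. t)"
        using \<open>finite V\<close> A by (simp add: sum.inter_restrict[symmetric] Int_absorb1)
      finally show ?thesis by simp
    qed
    have Max_y: "Max (y ` S i) = (if S i \<inter> A \<noteq> {} then t else 0) + Max (y' ` S i)" if "i \<in> I" for i
    proof -
      note Si = S_fin[OF that]
      have "Max (y' ` S i) \<in> y' ` S i"
        using Si by (intro Max_in) auto
      then obtain l where l: "l \<in> S i" "Max (y' ` S i) = y' l"
        by auto
      have l_max: "y' j \<le> y' l" if "j \<in> S i" for j
        using that Si by (simp flip: l(2))
      show ?thesis
      proof (cases "S i \<inter> A = {}")
        case True
        have "y' ` S i = y ` S i"
          using True by (intro image_cong) (auto simp: y'_def)
        then show ?thesis using True by simp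
      next
        case meet: False
        \<comment> \<open>A maximizer of \<open>y'\<close> outside \<open>A\<close> has value zero, and can be replaced by a point of \<open>A\<close>.\<close>
        obtain m where m: "m \<in> S i" "m \<in> A" "y' m = y' l"
        proof (cases "l \<in> A")
          case False
          obtain m where m: "m \<in> S i" "m \<in> A" using meet by auto
          have "y' l = 0"
            using False l Si by (auto simp: y'_def A_def)
          then have "y' m = y' l"
            using l_max[OF m(1)] y'_nonneg[of m] m A by auto
          then show ?thesis using that m by blast
        qed (use that l in blast)
        have "Max (y ` S i) = t + y' l"
        proof (rule Max_eqI)
          show "finite (y ` S i)" using Si by simp
          show "v \<le> t + y' l" if v: "v \<in> y ` S i" for v
          proof -
            obtain j where "j \<in> S i" "v = y j" using v by auto
            moreover have "y j \<le> t + y' j"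
              using \<open>0 < t\<close> by (simp add: y'_def)
            ultimately show ?thesis using l_max[of j] by linarith
          qed
          show "t + y' l \<in> y ` S i"
            using m by (intro image_eqI[of _ _ m]) (auto simp: y'_def split: if_splits)
        qed
        then show ?thesis using meet l by simp
      qed
    qed
    have "(\<Sum>i\<in>I. Max (y ` S i))
        = (\<Sum>i\<in>I. if S i \<inter> A \<noteq> {} then t else 0) + (\<Sum>i\<in>I. Max (y' ` S i))"
      using Max_y by (simp add: sum.distrib)
    also have "(\<Sum>i\<in>I. if S i \<inter> A \<noteq> {} then t else 0) = t * card {i \<in> I. S i \<inter> A \<noteq> {}}"
      using \<open>finite I\<close> by (simp add: sum.inter_filter[symmetric])
    finally have sum_Max: "(\<Sum>i\<in>I. Max (y ` S i))
        = t * card {i \<in> I. S i \<inter> A \<noteq> {}} + (\<Sum>i\<in>I. Max (y' ` S i))" .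
    have "t * (q * card A) \<le> t * (s * card {i \<in> I. S i \<inter> A \<noteq> {}})"
      using subsets[OF A(1) False] \<open>0 < t\<close> by (intro mult_left_mono) auto
    then show ?thesis
      using IH unfolding sum_y sum_Max by (simp add: algebra_simps)
  qed
qed

section \<open>Products of linear forms\<close>

lemma summable_on_prod_powr:
  fixes q :: real
  assumes "finite V" "1 < q"
  shows "(\<lambda>x. \<Prod>j\<in>V. real (x j) powr (- q)) summable_on (V \<rightarrow>\<^sub>E {1::nat..})"
proof -
  have "summable (\<lambda>n. norm (real n powr (- q)))"
    using assms(2) by (simp add: summable_real_powr_iff)
  then have "Infinite_Set_Sum.abs_summable_on (\<lambda>n. real n powr (- q)) UNIV"
    by (simp add: abs_summable_on_nat_iff')
  then have "Infinite_Set_Sum.abs_summable_on (\<lambda>n. real n powr (- q)) {1..}"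
    by (rule abs_summable_on_subset) auto
  then have "Infinite_Set_Sum.abs_summable_on (\<lambda>x. \<Prod>j\<in>V. real (x j) powr (- q)) (V \<rightarrow>\<^sub>E {1::nat..})"
    using assms(1) by (intro abs_summable_on_prod_PiE) auto
  then show ?thesis
    using abs_summable_equivalent abs_summable_summable by blast
qed

text \<open>
  A finite family of nonzero linear forms with nonnegative coefficients, indexed by \<open>I\<close>, in the
  variables indexed by \<open>V\<close>.
\<close>

locale linear_forms =
  fixes I :: "'i set" and V :: "'v set" and a :: "'i \<Rightarrow> 'v \<Rightarrow> real"
  assumes finite_I: "finite I"
    and finite_V: "finite V"
    and nonneg: "\<And>i j. i \<in> I \<Longrightarrow> j \<in> V \<Longrightarrow> 0 \<le> a i j"
    and pos: "\<And>i. i \<in> I \<Longrightarrow> \<exists>j\<in>V. 0 < a i j"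
begin

text \<open>The variables that occur in the \<open>i\<close>-th form.\<close>

definition supp :: "'i \<Rightarrow> 'v set" where
  "supp i = {j \<in> V. a i j \<noteq> 0}"

text \<open>
  The forms in which some variable of \<open>A\<close> occurs. The complementary forms are the factors of the
  subpolynomial on \<open>V - A\<close>.
\<close>

definition meeting :: "'v set \<Rightarrow> 'i set" where
  "meeting A = {i \<in> I. supp i \<inter> A \<noteq> {}}"

text \<open>The value of the \<open>i\<close>-th form at \<open>x\<close>, and the value of the product of all forms.\<close>

definition form :: "'i \<Rightarrow> ('v \<Rightarrow> real) \<Rightarrow> real" where
  "form i x = (\<Sum>j\<in>V. a i j * x j)"

definition form_prod :: "('v \<Rightarrow> real) \<Rightarrow> real" where
  "form_prod x = (\<Prod>i\<in>I. form i x)"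

lemma supp_props: "supp i \<subseteq> V" "finite (supp i)"
  using finite_V by (auto simp: supp_def)

lemma supp_nonempty: "i \<in> I \<Longrightarrow> supp i \<noteq> {}"
  using pos[of i] by (force simp: supp_def)

lemma supp_pos: "i \<in> I \<Longrightarrow> j \<in> supp i \<Longrightarrow> 0 < a i j"
  using nonneg[of i j] by (auto simp: supp_def)

text \<open>The value of a form at the all-ones point is the sum of its coefficients.\<close>

lemma form_one_pos:
  assumes "i \<in> I"
  shows "0 < form i (\<lambda>_. 1)"
proof -
  obtain j where "j \<in> V" "0 < a i j" using pos[OF assms] by auto
  then show ?thesis
    unfolding form_def using finite_V nonneg[OF assms] by (intro sum_pos2[of _ j]) auto
qed

lemma form_prod_one_pos: "0 < form_prod (\<lambda>_. 1)"
  unfolding form_prod_def using form_one_pos by (intro prod_pos) auto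

lemma form_mono:
  assumes "i \<in> I" "\<And>j. j \<in> V \<Longrightarrow> x j \<le> y j"
  shows "form i x \<le> form i y"
  unfolding form_def using assms nonneg by (intro sum_mono mult_left_mono) auto

lemma form_prod_one_le:
  assumes "\<And>j. j \<in> V \<Longrightarrow> 1 \<le> x j"
  shows "form_prod (\<lambda>_. 1) \<le> form_prod x"
  unfolding form_prod_def using form_mono form_one_pos assms
  by (intro prod_mono) (auto intro: less_imp_le)

text \<open>The constant is the least nonzero coefficient of the form.\<close>

lemma exists_lower_bound_form:
  assumes "i \<in> I"
  shows "\<exists>c>0. \<forall>x. (\<forall>j\<in>V. 1 \<le> x j) \<longrightarrow> c * exp (Max ((\<lambda>j. ln (x j)) ` supp i)) \<le> form i x"
proof (intro exI conjI allI impI)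
  let ?c = "Min (a i ` supp i)"
  have ne: "supp i \<noteq> {}" "finite (supp i)"
    using supp_nonempty[OF assms] supp_props by auto
  show "0 < ?c"
    using ne supp_pos[OF assms] by simp
  fix x :: "'v \<Rightarrow> real" assume x: "\<forall>j\<in>V. 1 \<le> x j"
  have "Max ((\<lambda>j. ln (x j)) ` supp i) \<in> (\<lambda>j. ln (x j)) ` supp i"
    using ne by (intro Max_in) auto
  then obtain k where k: "k \<in> supp i" "Max ((\<lambda>j. ln (x j)) ` supp i) = ln (x k)"
    by auto
  have kV: "k \<in> V" "1 \<le> x k" using k supp_props x by auto
  have "?c * exp (Max ((\<lambda>j. ln (x j)) ` supp i)) = ?c * x k"
    using kV k by simp
  also have "\<dots> \<le> a i k * x k"
    using ne k kV by (intro mult_right_mono) auto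
  also have "\<dots> \<le> form i x"
    unfolding form_def using finite_V kV nonneg[OF assms] x
    by (intro member_le_sum mult_nonneg_nonneg) (force intro: order.trans[OF zero_le_one])+
  finally show "?c * exp (Max ((\<lambda>j. ln (x j)) ` supp i)) \<le> form i x" .
qed

lemma exists_lower_bound_form_prod:
  fixes q s :: real
  assumes "0 \<le> s"
    and subsets: "\<And>A. A \<subseteq> V \<Longrightarrow> A \<noteq> {} \<Longrightarrow> q * card A \<le> s * card (meeting A)"
  shows "\<exists>K>0. \<forall>x. (\<forall>j\<in>V. 1 \<le> x j) \<longrightarrow> K * (\<Prod>j\<in>V. x j powr q) \<le> form_prod x powr s"
proof -
  have "\<forall>i\<in>I. \<exists>c>0. \<forall>x. (\<forall>j\<in>V. 1 \<le> x j)
      \<longrightarrow> c * exp (Max ((\<lambda>j. ln (x j)) ` supp i)) \<le> form i x"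
    using exists_lower_bound_form by blast
  then obtain c where c: "\<And>i. i \<in> I \<Longrightarrow> 0 < c i"
    and le: "\<And>i x. i \<in> I \<Longrightarrow> (\<And>j. j \<in> V \<Longrightarrow> 1 \<le> x j) \<Longrightarrow>
      c i * exp (Max ((\<lambda>j. ln (x j)) ` supp i)) \<le> form i x"
    by metis
  let ?C = "\<Prod>i\<in>I. c i"
  have C: "0 < ?C" using c by (intro prod_pos) auto
  show ?thesis
  proof (intro exI conjI allI impI)
    show "0 < ?C powr s" using C by simp
    fix x :: "'v \<Rightarrow> real" assume "\<forall>j\<in>V. 1 \<le> x j"
    then have x: "1 \<le> x j" if "j \<in> V" for j using that by blast
    let ?M = "\<lambda>i. Max ((\<lambda>j. ln (x j)) ` supp i)"
    have "(\<Prod>j\<in>V. x j powr q) = (\<Prod>j\<in>V. exp (q * ln (x j)))"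
      using x by (intro prod.cong) (fastforce simp: powr_def)+
    also have "\<dots> = exp (q * (\<Sum>j\<in>V. ln (x j)))"
      using finite_V by (simp add: exp_sum sum_distrib_left)
    also have "\<dots> \<le> exp (s * (\<Sum>i\<in>I. ?M i))"
      using weighted_sum_le_sum_Max[of I V supp q s "\<lambda>j. ln (x j)"] finite_I finite_V supp_props
        supp_nonempty subsets x by (simp add: meeting_def)
    also have "\<dots> = (\<Prod>i\<in>I. exp (?M i)) powr s"
      using finite_I by (simp add: powr_def exp_sum[symmetric])
    finally have "?C powr s * (\<Prod>j\<in>V. x j powr q) \<le> ?C powr s * (\<Prod>i\<in>I. exp (?M i)) powr s"
      by (intro mult_left_mono) auto
    also have "\<dots> = (\<Prod>i\<in>I. c i * exp (?M i)) powr s"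
      using C by (simp add: prod.distrib powr_mult prod_nonneg)
    also have "\<dots> \<le> form_prod x powr s"
      unfolding form_prod_def using c le[of _ x] x assms(1)
      by (intro powr_mono2 prod_mono prod_nonneg) (auto simp: less_imp_le)
    finally show "?C powr s * (\<Prod>j\<in>V. x j powr q) \<le> form_prod x powr s" .
  qed
qed

lemma summable_form_prod_powr:
  fixes q s :: real
  assumes "0 \<le> s" "1 < q"
    and "\<And>A. A \<subseteq> V \<Longrightarrow> A \<noteq> {} \<Longrightarrow> q * card A \<le> s * card (meeting A)"
  shows "(\<lambda>x. form_prod (\<lambda>j. real (x j)) powr (- s)) summable_on (V \<rightarrow>\<^sub>E {1::nat..})"
proof -
  obtain K where K: "0 < K"
    and le: "\<And>x. (\<And>j. j \<in> V \<Longrightarrow> 1 \<le> x j) \<Longrightarrow> K * (\<Prod>j\<in>V. x j powr q) \<le> form_prod x powr s"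
    using exists_lower_bound_form_prod[of s q] assms by metis
  show ?thesis
  proof (rule summable_on_comparison_test)
    show "(\<lambda>x. inverse K * (\<Prod>j\<in>V. real (x j) powr (- q))) summable_on (V \<rightarrow>\<^sub>E {1::nat..})"
      using summable_on_prod_powr[OF finite_V assms(2)] by (rule summable_on_cmult_right)
    fix x assume "x \<in> V \<rightarrow>\<^sub>E {1::nat..}"
    then have x: "1 \<le> real (x j)" if "j \<in> V" for j
      using that by (auto dest: PiE_mem)
    have "0 < (\<Prod>j\<in>V. real (x j) powr q)"
      using x by (intro prod_pos) force
    then have "inverse (form_prod (\<lambda>j. real (x j)) powr s)
        \<le> inverse (K * (\<Prod>j\<in>V. real (x j) powr q))"
      using K le[of "\<lambda>j. real (x j)"] x by (intro le_imp_inverse_le) auto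
    then show "form_prod (\<lambda>j. real (x j)) powr (- s)
        \<le> inverse K * (\<Prod>j\<in>V. real (x j) powr (- q))"
      by (simp add: powr_minus prod_inversef[symmetric] o_def)
  qed simp
qed

lemma form_prod_box_le:
  assumes "1 \<le> N"
    and x: "\<And>j. j \<in> V \<Longrightarrow> 0 \<le> x j \<and> x j \<le> (if j \<in> A then N else 1)"
  shows "form_prod x \<le> form_prod (\<lambda>_. 1) * N ^ card (meeting A)"
proof -
  let ?u = "\<lambda>i. if i \<in> meeting A then N else 1"
  have "form_prod x \<le> (\<Prod>i\<in>I. form i (\<lambda>_. 1) * ?u i)"
    unfolding form_prod_def
  proof (intro prod_mono conjI)
    fix i assume i: "i \<in> I"
    show "0 \<le> form i x"
      unfolding form_def using nonneg[OF i] x by (intro sum_nonneg mult_nonneg_nonneg) auto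
    have "a i j * x j \<le> a i j * ?u i" if j: "j \<in> V" for j
    proof (cases "a i j = 0")
      case False
      then have "j \<in> A \<Longrightarrow> i \<in> meeting A"
        using i j by (auto simp: meeting_def supp_def)
      then have "x j \<le> ?u i"
        using x[OF j] assms(1) by (auto split: if_splits)
      then show ?thesis using nonneg[OF i j] by (rule mult_left_mono)
    qed simp
    then show "form i x \<le> form i (\<lambda>_. 1) * ?u i"
      unfolding form_def by (simp add: sum_distrib_right sum_mono)
  qed
  also have "(\<Prod>i\<in>I. form i (\<lambda>_. 1) * ?u i) = form_prod (\<lambda>_. 1) * N ^ card (meeting A)"
  proof -
    have "(\<Prod>i\<in>I. ?u i) = (\<Prod>i\<in>meeting A. N)"
      using finite_I by (intro prod.mono_neutral_cong_right) (auto simp: meeting_def)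
    then show ?thesis by (simp add: prod.distrib form_prod_def)
  qed
  finally show ?thesis .
qed

text \<open>
  The maximum with \<open>0\<close> covers negative exponents: for \<open>s \<le> 0\<close> the terms are bounded below by a
  positive constant, which leaves no room for a nonempty \<open>A\<close>.
\<close>

lemma card_le_of_summable:
  fixes s :: real
  assumes summable: "(\<lambda>x. form_prod (\<lambda>j. real (x j)) powr (- s)) summable_on (V \<rightarrow>\<^sub>E {1::nat..})"
    and A: "A \<subseteq> V"
  shows "card A \<le> max s 0 * card (meeting A)"
proof (rule ccontr)
  assume "\<not> ?thesis"
  then have less: "max s 0 * card (meeting A) < card A" by simp
  define f where "f = (\<lambda>x :: 'v \<Rightarrow> nat. form_prod (\<lambda>j. real (x j)) powr (- s))"
  define M where "M = infsum f (V \<rightarrow>\<^sub>E {1..})"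
  define K where "K = form_prod (\<lambda>_. 1) powr (- s)"
  define e where "e = card A - max s 0 * card (meeting A)"
  have K: "0 < K" using form_prod_one_pos by (simp add: K_def)
  have e: "0 < e" using less by (simp add: e_def)
  \<comment> \<open>The series is at least its part over a box of side \<open>N\<close> in the directions of \<open>A\<close> only.\<close>
  have bound: "K * real N powr e \<le> M" if N: "1 \<le> N" for N :: nat
  proof -
    define B where "B = PiE V (\<lambda>j. if j \<in> A then {1..N} else {1})"
    have B_sub: "B \<subseteq> V \<rightarrow>\<^sub>E {1..}"
      unfolding B_def by (intro PiE_mono) auto
    have B_fin: "finite B"
      unfolding B_def using finite_V by (intro finite_PiE) auto
    have B_card: "card B = N ^ card A"
    proof -
      have "card B = (\<Prod>j\<in>V. if j \<in> A then N else 1)"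
        unfolding B_def using finite_V by (subst card_PiE) (auto intro: prod.cong)
      also have "\<dots> = (\<Prod>j\<in>A. N)"
        using finite_V A by (intro prod.mono_neutral_cong_right) auto
      finally show ?thesis by simp
    qed
    have term_ge: "K * real N powr (- (max s 0 * card (meeting A))) \<le> f x" if x: "x \<in> B" for x
    proof -
      have xj: "1 \<le> x j \<and> x j \<le> (if j \<in> A then N else 1)" if "j \<in> V" for j
        using x that by (auto simp: B_def dest: PiE_mem split: if_splits)
      have lower: "form_prod (\<lambda>_. 1) \<le> form_prod (\<lambda>j. real (x j))"
        using xj by (intro form_prod_one_le) simp
      have "form_prod (\<lambda>j. real (x j)) \<le> form_prod (\<lambda>_. 1) * real N ^ card (meeting A)"
        using xj N by (intro form_prod_box_le) (fastforce split: if_splits)+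
      then have upper: "form_prod (\<lambda>j. real (x j))
          \<le> form_prod (\<lambda>_. 1) * real N powr card (meeting A)"
        using N by (simp add: powr_realpow)
      show ?thesis
      proof (cases "0 \<le> s")
        case True
        have "K * real N powr (- (max s 0 * card (meeting A)))
            = (form_prod (\<lambda>_. 1) * real N powr card (meeting A)) powr (- s)"
          using True form_prod_one_pos
          by (simp add: K_def powr_mult powr_powr mult.commute)
        also have "\<dots> \<le> f x"
          unfolding f_def using True upper lower form_prod_one_pos by (intro powr_mono2') auto
        finally show ?thesis .
      next
        case False
        then have "K * real N powr (- (max s 0 * card (meeting A))) = K"
          using N by simp
        also have "\<dots> \<le> f x"
          unfolding f_def K_def using False lower form_prod_one_pos by (intro powr_mono2) auto
        finally show ?thesis .
      qed
    qed
    have "K * real N powr e = real (card B) * (K * real N powr (- (max s 0 * card (meeting A))))"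
      using N by (simp add: B_card e_def powr_diff powr_minus powr_realpow divide_inverse)
    also have "\<dots> \<le> sum f B"
      using term_ge by (intro sum_bounded_below) auto
    also have "\<dots> \<le> M"
      unfolding M_def f_def using summable B_fin B_sub by (intro finite_sum_le_infsum) auto
    finally show ?thesis .
  qed
  have "filterlim (\<lambda>N. real N powr e) at_top sequentially"
    using e by real_asymp
  then have "\<forall>\<^sub>F N in sequentially. M / K < real N powr e"
    by (auto simp: filterlim_at_top_dense)
  then have "\<forall>\<^sub>F N in sequentially. M / K < real N powr e \<and> 1 \<le> N"
    using eventually_ge_at_top by (rule eventually_conj)
  then obtain N where "M / K < real N powr e" "1 \<le> N"
    by (metis (mono_tags, lifting) eventually_sequentially order_refl)
  then show False
    using bound[of N] K by (simp add: field_simps)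
qed

lemma meeting_V: "meeting V = I"
  using supp_nonempty by (auto simp: meeting_def Int_absorb2[OF supp_props(1)])

lemma card_meeting_compl:
  "card (meeting (V - J)) = card I - card {i \<in> I. supp i \<subseteq> J}"
proof -
  have "meeting (V - J) = I - {i \<in> I. supp i \<subseteq> J}"
    using supp_props by (auto simp: meeting_def)
  then show ?thesis
    using finite_I by (simp add: card_Diff_subset)
qed

text \<open>
  The number \<open>card V / card I\<close> is always a lower bound for the exponents of convergence, by the case
  \<open>A = V\<close> of the counting bound.
\<close>

lemma Inf_abscissa_eq_iff:
  assumes "I \<noteq> {}" "V \<noteq> {}"
  shows "Inf {ereal s | s. (\<lambda>x. form_prod (\<lambda>j. real (x j)) powr (- s)) summable_on (V \<rightarrow>\<^sub>E {1::nat..})}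
      = ereal (card V / card I) \<longleftrightarrow>
    (\<forall>A. A \<subseteq> V \<and> A \<noteq> {} \<longrightarrow> card A * card I \<le> card V * card (meeting A))"
    (is "Inf ?E = _ \<longleftrightarrow> ?R")
proof -
  have card_pos: "0 < card I" "0 < card V"
    using assms finite_I finite_V by (auto simp: card_gt_0_iff)
  have upper: "card A \<le> s * card (meeting A)"
    if "ereal s \<in> ?E" "A \<subseteq> V" for s :: real and A
  proof -
    have le: "card B \<le> max s 0 * card (meeting B)" if "B \<subseteq> V" for B
      using \<open>ereal s \<in> ?E\<close> that by (auto intro: card_le_of_summable)
    have "0 < s"
      using le[of V] card_pos by (cases "0 < s") (auto simp: max_def)
    then show "card A \<le> s * card (meeting A)"
      using le[OF \<open>A \<subseteq> V\<close>] by simp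
  qed
  show ?thesis
  proof
    assume Inf: "Inf ?E = ereal (card V / card I)"
    show ?R
    proof (intro allI impI, elim conjE)
      fix A assume A: "A \<subseteq> V" "A \<noteq> {}"
      show "card A * card I \<le> card V * card (meeting A)"
      proof (cases "meeting A = {}")
        case True
        \<comment> \<open>The infimum is finite, so the counting bound holds for some exponent.\<close>
        have "?E \<noteq> {}"
          using Inf by (metis Inf_empty top_ereal_def PInfty_neq_ereal(1))
        then obtain s where "ereal s \<in> ?E" by blast
        then have "card A = 0"
          using upper[of s A] A True by simp
        then show ?thesis by simp
      next
        case False
        then have m: "0 < card (meeting A)"
          using finite_I by (simp add: card_gt_0_iff meeting_def)
        have "ereal (card A / card (meeting A)) \<le> Inf ?E"
        proof (rule Inf_greatest)
          fix z assume z: "z \<in> ?E"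
          then obtain s where "z = ereal s" by blast
          then show "ereal (card A / card (meeting A)) \<le> z"
            using upper[of s A] z A m by (simp add: field_simps)
        qed
        then have "card A / card (meeting A) \<le> card V / card I"
          using Inf by simp
        then have "real (card A * card I) \<le> real (card V * card (meeting A))"
          using m card_pos by (simp add: field_simps)
        then show ?thesis by linarith
      qed
    qed
  next
    assume R: ?R
    show "Inf ?E = ereal (card V / card I)"
    proof (rule antisym)
      show "ereal (card V / card I) \<le> Inf ?E"
      proof (rule Inf_greatest)
        fix z assume z: "z \<in> ?E"
        then obtain s where "z = ereal s" by blast
        then show "ereal (card V / card I) \<le> z"
          using upper[of s V] z card_pos by (simp add: meeting_V field_simps)
      qed
      show "Inf ?E \<le> ereal (card V / card I)"
      proof (rule ereal_le_epsilon2)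
        fix e :: real assume e: "0 < e"
        define s where "s = card V / card I + e"
        have s: "0 \<le> s" using e by (simp add: s_def)
        have "(\<lambda>x. form_prod (\<lambda>j. real (x j)) powr (- s)) summable_on (V \<rightarrow>\<^sub>E {1::nat..})"
        proof (rule summable_form_prod_powr[OF s])
          show "1 < s * card I / card V"
            using card_pos e by (simp add: s_def field_simps)
          fix A assume "A \<subseteq> V" "A \<noteq> {}"
          then have "real (card A * card I) \<le> real (card V * card (meeting A))"
            using R by (intro of_nat_mono) blast
          then have "s * (card A * card I) \<le> s * (card V * card (meeting A))"
            using s by (intro mult_left_mono) auto
          then show "s * card I / card V * card A \<le> s * card (meeting A)"
            using card_pos by (simp add: field_simps)
        qed
        then have "Inf ?E \<le> ereal s"
          by (intro Inf_lower) blast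
        then show "Inf ?E \<le> ereal (card V / card I) + ereal e"
          by (simp add: s_def)
      qed
    qed
  qed
qed

end

section \<open>The abscissa of convergence and subpolynomials\<close>

theorem corollary2p4:
  fixes r \<kappa> :: nat and a :: "nat \<Rightarrow> nat \<Rightarrow> real" and P :: lin_prod
  assumes "r \<ge> 1"
    and "\<And>i j. i \<in> {1..\<kappa>} \<Longrightarrow> j \<in> {1..r} \<Longrightarrow> a i j \<ge> 0"
    and "\<And>i. i \<in> {1..\<kappa>} \<Longrightarrow> \<exists>j\<in>{1..r}. a i j > 0"
    and "P = Lin_Prod {1..r} (map a [1..<Suc \<kappa>])"
  shows "abscissa_of_convergence P = ereal (real r) / ereal (real \<kappa>) \<longleftrightarrow>
    (\<forall>J. J \<subseteq> {1..r} \<and> J \<noteq> {} \<longrightarrow>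
       var_factor_ratio (subpoly P J) \<ge> ereal (real r) / ereal (real \<kappa>))"
proof -
  interpret linear_forms "{1..\<kappa>}" "{1..r}" a
    using assms(2,3) by unfold_locales auto
  have eval: "eval_lin_prod P x = form_prod x" for x
  proof -
    have "eval_lin_prod P x = (\<Prod>i\<leftarrow>[1..<Suc \<kappa>]. form i x)"
      unfolding eval_lin_prod_def form_def by (simp add: assms(4) o_def del: upt_Suc)
    also have "\<dots> = form_prod x"
      unfolding form_prod_def
      by (subst prod.distinct_set_conv_list[symmetric]) (auto intro: prod.cong)
    finally show ?thesis .
  qed
  have num: "num_factors (subpoly P J) = card {i \<in> {1..\<kappa>}. supp i \<subseteq> J}" for J
  proof -
    have "num_factors (subpoly P J) = length (filter (\<lambda>i. supp i \<subseteq> J) [1..<Suc \<kappa>])"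
      unfolding num_factors_def subpoly_def supp_def
      by (simp add: assms(4) filter_map o_def del: upt_Suc)
    also have "\<dots> = card (set (filter (\<lambda>i. supp i \<subseteq> J) [1..<Suc \<kappa>]))"
      by (intro distinct_card[symmetric] distinct_filter distinct_upt)
    also have "set (filter (\<lambda>i. supp i \<subseteq> J) [1..<Suc \<kappa>]) = {i \<in> {1..\<kappa>}. supp i \<subseteq> J}"
      by auto
    finally show ?thesis .
  qed
  have ratio: "var_factor_ratio (subpoly P J)
      = ereal (card J) / ereal (card {i \<in> {1..\<kappa>}. supp i \<subseteq> J})" for J
    by (simp only: var_factor_ratio_def num num_vars_def) (simp add: subpoly_def)
  have abscissa: "abscissa_of_convergence P = Inf {ereal s | s.
      (\<lambda>x. form_prod (\<lambda>j. real (x j)) powr (- s)) summable_on ({1..r} \<rightarrow>\<^sub>E {1::nat..})}"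
    unfolding abscissa_of_convergence_def zeta_converges_def eval by (simp add: assms(4))
  show ?thesis
  proof (cases "\<kappa> = 0")
    case True
    \<comment> \<open>Without factors all terms of the series are \<open>1\<close>, and both sides of the equivalence hold,
      all quotients being \<open>\<infinity>\<close>.\<close>
    have "\<not> (\<lambda>x. form_prod (\<lambda>j. real (x j)) powr (- s)) summable_on ({1..r} \<rightarrow>\<^sub>E {1::nat..})" for s
      using card_le_of_summable[of s "{1..r}"] assms(1) True meeting_V by auto
    then have "abscissa_of_convergence P = \<infinity>"
      by (simp add: abscissa top_ereal_def)
    moreover have "ereal (real n) / ereal 0 = \<infinity>" if "0 < n" for n
      using that by (simp add: divide_ereal_def)
    moreover have "0 < card J" if "J \<subseteq> {1..r}" "J \<noteq> {}" for J
      using that finite_subset by (fastforce simp: card_gt_0_iff)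
    ultimately have "var_factor_ratio (subpoly P J) = \<infinity>" if "J \<subseteq> {1..r}" "J \<noteq> {}" for J
      using that True by (simp add: ratio)
    then show ?thesis
      using assms(1) True \<open>abscissa_of_convergence P = \<infinity>\<close> by (simp add: divide_ereal_def)
  next
    case False
    have ratio_iff: "ereal (real r) / ereal (real \<kappa>) \<le> var_factor_ratio (subpoly P J) \<longleftrightarrow>
        card ({1..r} - J) * \<kappa> \<le> r * card (meeting ({1..r} - J))"
      if J: "J \<subseteq> {1..r}" "J \<noteq> {}" for J
    proof -
      define k where "k = card {i \<in> {1..\<kappa>}. supp i \<subseteq> J}"
      have ratio_k: "var_factor_ratio (subpoly P J) = ereal (card J) / ereal k"
        unfolding ratio k_def ..
      have card_meeting: "card (meeting ({1..r} - J)) = \<kappa> - k"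
        unfolding k_def card_meeting_compl by simp
      have J_card: "0 < card J" "card J \<le> r"
        using J finite_subset card_mono[OF _ J(1)] by (fastforce simp: card_gt_0_iff)+
      have "k \<le> card {1..\<kappa>}"
        unfolding k_def by (intro card_mono) auto
      then have k_le: "k \<le> \<kappa>"
        by simp
      have "ereal (real r) / ereal (real \<kappa>) \<le> var_factor_ratio (subpoly P J)
          \<longleftrightarrow> real r * real k \<le> real (card J) * real \<kappa>"
      proof (cases "k = 0")
        case True
        then show ?thesis
          using J_card by (simp add: ratio_k divide_ereal_def)
      next
        case False
        then have "0 < real k" by simp
        then show ?thesis
          using \<open>\<kappa> \<noteq> 0\<close> by (simp add: ratio_k field_simps)
      qed
      also have "\<dots> \<longleftrightarrow> (real r - card J) * real \<kappa> \<le> real r * (real \<kappa> - k)"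
        by (simp add: algebra_simps)
      also have "\<dots> \<longleftrightarrow> real (card ({1..r} - J) * \<kappa>) \<le> real (r * card (meeting ({1..r} - J)))"
        unfolding card_meeting using J J_card k_le finite_subset[OF J(1)]
        by (simp add: card_Diff_subset of_nat_diff)
      finally show ?thesis by (simp only: of_nat_le_iff)
    qed
    have "abscissa_of_convergence P = ereal (real r) / ereal (real \<kappa>) \<longleftrightarrow>
        (\<forall>A. A \<subseteq> {1..r} \<and> A \<noteq> {} \<longrightarrow> card A * \<kappa> \<le> r * card (meeting A))"
      using Inf_abscissa_eq_iff assms(1) False by (simp add: abscissa)
    also have "\<dots> \<longleftrightarrow> (\<forall>J. J \<subseteq> {1..r} \<and> J \<noteq> {} \<longrightarrow>
        card ({1..r} - J) * \<kappa> \<le> r * card (meeting ({1..r} - J)))"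
    proof (intro iffI allI impI; elim conjE)
      fix J assume *: "\<forall>A. A \<subseteq> {1..r} \<and> A \<noteq> {} \<longrightarrow> card A * \<kappa> \<le> r * card (meeting A)"
      show "card ({1..r} - J) * \<kappa> \<le> r * card (meeting ({1..r} - J))"
      proof (cases "{1..r} - J = {}")
        case True
        then show ?thesis by (simp only: card.empty mult_0 zero_le)
      next
        case False
        then show ?thesis using * by (metis Diff_subset)
      qed
    next
      fix A assume *: "\<forall>J. J \<subseteq> {1..r} \<and> J \<noteq> {} \<longrightarrow>
          card ({1..r} - J) * \<kappa> \<le> r * card (meeting ({1..r} - J))"
        and A: "A \<subseteq> {1..r}" "A \<noteq> {}"
      show "card A * \<kappa> \<le> r * card (meeting A)"
      proof (cases "A = {1..r}")
        case True
        then show ?thesis using meeting_V by simp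
      next
        case ne: False
        have "{1..r} - ({1..r} - A) = A" "{1..r} - A \<noteq> {}"
          using A ne by auto
        then show ?thesis
          using * by (metis Diff_subset)
      qed
    qed
    also have "\<dots> \<longleftrightarrow> (\<forall>J. J \<subseteq> {1..r} \<and> J \<noteq> {} \<longrightarrow>
        var_factor_ratio (subpoly P J) \<ge> ereal (real r) / ereal (real \<kappa>))"
      by (intro all_cong1 imp_cong refl) (elim conjE, rule ratio_iff[symmetric])
    finally show ?thesis .
  qed
qed

end
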